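(* Let $G$ be a finite connected graph. Then $|\sigma^{\times}_E(G)-\sigma^{\square}_E(G)|\le 1$.
   Context: All graphs are finite, simple, nonempty and connected; $\mathbb{N}_l=\{1,\dots,l\}$ (with $\mathbb{N}_0=\emptyset$), and $d_G$ is the usual shortest-path distance. Let $G$ be a graph and $l\in\mathbb{N}$, $l\ge 1$. A surjective function $f:\mathbb{N}_l\to V(G)$ is an $l$-track on $G$ if $f(i)f(i+1)\in E(G)$ for every $i\in\mathbb{N}_{l-1}$; it is a lazy $l$-track if for every $i\in\mathbb{N}_{l-1}$ either $f(i)f(i+1)\in E(G)$ or $f(i)=f(i+1)$. An $l$-sweep (respectively lazy $l$-sweep) is an $l$-track (respectively lazy $l$-track) $f$ such that for every edge $uv\in E(G)$ there is $i\in\mathbb{N}_{l-1}$ with $f(i)f(i+1)=uv$ (as unordered pairs). Two lazy $l$-sweeps $f,g$ are opposite if for all $i\in\mathbb{N}_{l-1}$: $f(i)f(i+1)\in E(G)\iff g(i)=g(i+1)$. For lazy $l$-sweeps $f,g$ put $m_G(f,g)=\min\{d_G(f(i),g(i)) : i\in\mathbb{N}_l\}$. The direct edge span $\sigma^{\times}_E(G)$ is the maximum of $m_G(f,g)$ over all $l$ and all pairs $(f,g)$ of $l$-sweeps on $G$. The Cartesian edge span $\sigma^{\square}_E(G)$ is the maximum of $m_G(f,g)$ over all $l$ and all pairs $(f,g)$ of opposite lazy $l$-sweeps on $G$. *)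

theory Defs
  imports "Graph_Theory.Graph_Theory"
begin

text \<open>
  Undirected simple graphs are rendered by the locale \<^locale>\<open>graph\<close>: finite digraphs without
  loops and parallel arcs whose adjacency relation is symmetric, so that an edge \<open>uv\<close> is a pair of
  opposite arcs, and \<open>uv\<close> is an edge iff \<open>u \<rightarrow>\<^bsub>G\<^esub> v\<close>. Note that \<^const>\<open>Digraph_Component.connected\<close>
  includes nonemptiness of the vertex set.
\<close>

text \<open>
  On pairs of vertices without a connecting walk this is the junk value \<open>Inf {} = 0\<close>; this does
  not occur in connected graphs.
\<close>
definition gdist :: "('a, 'b) pre_digraph \<Rightarrow> 'a \<Rightarrow> 'a \<Rightarrow> nat" where
  "gdist G u v = Inf {length p | p. pre_digraph.awalk G u p v}"

lemma (in wf_digraph) gdist_eq_mu: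
  assumes "u \<rightarrow>\<^sup>* v"
  shows "ereal (real (gdist G u v)) = \<mu> (\<lambda>_. 1) u v"
proof -
  let ?L = "{length p | p. awalk u p v}"
  have cost: "awalk_cost (\<lambda>_. 1) p = real (length p)" for p
    by (simp add: awalk_cost_def sum_list_triv)
  from assms have "?L \<noteq> {}"
    by (auto simp: reachable_awalk)
  then have "gdist G u v \<in> ?L"
    unfolding gdist_def by (rule Inf_nat_def1)
  then obtain p where p: "awalk u p v" "gdist G u v = length p"
    by blast
  show ?thesis
  proof (rule antisym)
    show "ereal (real (gdist G u v)) \<le> \<mu> (\<lambda>_. 1) u v"
      unfolding \<mu>_def
    proof (rule INF_greatest)
      fix q assume "q \<in> {p. awalk u p v}"
      then have "gdist G u v \<le> length q"
        unfolding gdist_def by (intro cInf_lower) auto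
      then show "ereal (real (gdist G u v)) \<le> ereal (awalk_cost (\<lambda>_. 1) q)"
        by (simp add: cost)
    qed
    show "\<mu> (\<lambda>_. 1) u v \<le> ereal (real (gdist G u v))"
      using min_cost_le_walk_cost[OF p(1), of "\<lambda>_. 1"] p(2) by (simp add: cost)
  qed
qed

text \<open>
  A function on \<open>{1..l}\<close> is represented by a function on \<^typ>\<open>nat\<close>, of which only the values
  on \<open>{1..l}\<close> matter. The index set for consecutive pairs, \<open>{1,\<dots>,l-1}\<close>, is \<open>{1..<l}\<close>.
\<close>

definition track :: "('a, 'b) pre_digraph \<Rightarrow> nat \<Rightarrow> (nat \<Rightarrow> 'a) \<Rightarrow> bool" where
  "track G l f \<longleftrightarrow> l \<ge> 1 \<and> f ` {1..l} = verts G \<and> (\<forall>i\<in>{1..<l}. f i \<rightarrow>\<^bsub>G\<^esub> f (i + 1))"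

definition lazy_track :: "('a, 'b) pre_digraph \<Rightarrow> nat \<Rightarrow> (nat \<Rightarrow> 'a) \<Rightarrow> bool" where
  "lazy_track G l f \<longleftrightarrow> l \<ge> 1 \<and> f ` {1..l} = verts G \<and>
     (\<forall>i\<in>{1..<l}. f i \<rightarrow>\<^bsub>G\<^esub> f (i + 1) \<or> f i = f (i + 1))"

definition covers_edges :: "('a, 'b) pre_digraph \<Rightarrow> nat \<Rightarrow> (nat \<Rightarrow> 'a) \<Rightarrow> bool" where
  "covers_edges G l f \<longleftrightarrow> (\<forall>u v. u \<rightarrow>\<^bsub>G\<^esub> v \<longrightarrow> (\<exists>i\<in>{1..<l}. {f i, f (i + 1)} = {u, v}))"

definition sweep :: "('a, 'b) pre_digraph \<Rightarrow> nat \<Rightarrow> (nat \<Rightarrow> 'a) \<Rightarrow> bool" where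
  "sweep G l f \<longleftrightarrow> track G l f \<and> covers_edges G l f"

definition lazy_sweep :: "('a, 'b) pre_digraph \<Rightarrow> nat \<Rightarrow> (nat \<Rightarrow> 'a) \<Rightarrow> bool" where
  "lazy_sweep G l f \<longleftrightarrow> lazy_track G l f \<and> covers_edges G l f"

definition opposite :: "('a, 'b) pre_digraph \<Rightarrow> nat \<Rightarrow> (nat \<Rightarrow> 'a) \<Rightarrow> (nat \<Rightarrow> 'a) \<Rightarrow> bool" where
  "opposite G l f g \<longleftrightarrow> (\<forall>i\<in>{1..<l}. f i \<rightarrow>\<^bsub>G\<^esub> f (i + 1) \<longleftrightarrow> g i = g (i + 1))"

definition min_dist :: "('a, 'b) pre_digraph \<Rightarrow> nat \<Rightarrow> (nat \<Rightarrow> 'a) \<Rightarrow> (nat \<Rightarrow> 'a) \<Rightarrow> nat" where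
  "min_dist G l f g = Min ((\<lambda>i. gdist G (f i) (g i)) ` {1..l})"

text \<open>
  The sets below are bounded by the diameter of \<open>G\<close>, and for connected \<open>G\<close> they are nonempty,
  so the maxima exist.
\<close>

definition direct_edge_span :: "('a, 'b) pre_digraph \<Rightarrow> nat" where
  "direct_edge_span G = Max {min_dist G l f g | l f g. sweep G l f \<and> sweep G l g}"

definition cartesian_edge_span :: "('a, 'b) pre_digraph \<Rightarrow> nat" where
  "cartesian_edge_span G =
     Max {min_dist G l f g | l f g. lazy_sweep G l f \<and> lazy_sweep G l g \<and> opposite G l f g}"

end

theory Submission
  imports Defs
begin

text \<open>
  The two spans differ by at most one because each kind of joint motion can be turned into the
  other at the price of moving one of the two players by a single extra step at a time, which
  changes the distance between them by at most one.

  From simultaneous moves to alternating moves: replace each simultaneous move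
  \<open>(a, c) \<leadsto> (b, e)\<close> by \<open>(a, c) \<leadsto> (b, c) \<leadsto> (b, e)\<close>. Only the new intermediate position can be worse,
  and it is one step away from \<open>(a, c)\<close>. This is \<open>opposite_sweeps_of_sweeps\<close>.

  From alternating moves to simultaneous moves: in a pair of opposite lazy sweeps exactly one player
  moves at each time. Cut the time into blocks of two consecutive moves. If different players
  move in a block, merge both moves into a single simultaneous one; this visits no new
  position. If the same player moves twice, \<open>(a, c) \<leadsto> (b, c) \<leadsto> (b', c)\<close>, let the other one make a
  detour to a neighbour \<open>c'\<close> and back, \<open>(a, c) \<leadsto> (b, c') \<leadsto> (b', c)\<close>. The new position \<open>(b, c')\<close> is one
  step away from the old \<open>(b, c)\<close>. A block always ends at a position of the original motion, so
  that the losses do not add up; a last unpaired move is treated like the first half of a detour.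
  This is \<open>sweeps_of_opposite_sweeps\<close>.

  A block becomes one or two simultaneous moves, depending on who moves in it. The times of the new
  motion are therefore no fixed function of the old ones, and the new motion is built by appending
  positions to a \<^emph>\<open>joint walk\<close> while recording the edges traced so far. Appending also shows that
  sweeps exist at all (\<open>sweep_exists\<close>), so that both spans are maxima of nonempty sets of distances,
  which are finite because \<open>G\<close> is.
\<close>

section \<open>Distances\<close>

locale connected_graph = graph G for G :: "('a, 'b) pre_digraph" (structure) +
  assumes connected_G: "Digraph_Component.connected G"
begin

lemma reachable_verts:
  assumes "u \<in> verts G" "v \<in> verts G"
  shows "u \<rightarrow>\<^sup>* v"
  using assms symmetric_connected_imp_strongly_connected[OF sym_arcs connected_G]
  by (auto simp: strongly_connected_def)

lemma adj_sym: "u \<rightarrow> v \<Longrightarrow> v \<rightarrow> u"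
  by (rule arcs_ends_symmetric[OF sym_arcs])

lemma adj_distinct: "u \<rightarrow> v \<Longrightarrow> u \<noteq> v"
  using adj_not_same by blast

lemma gdist_le_length: "awalk u p v \<Longrightarrow> gdist G u v \<le> length p"
  unfolding gdist_def by (intro cInf_lower) auto

lemma shortest_awalk:
  assumes "u \<in> verts G" "v \<in> verts G"
  obtains p where "awalk u p v" "gdist G u v = length p"
proof -
  have "{length p | p. awalk u p v} \<noteq> {}"
    using reachable_verts[OF assms] by (auto simp: reachable_awalk)
  then have "gdist G u v \<in> {length p | p. awalk u p v}"
    unfolding gdist_def by (rule Inf_nat_def1)
  with that show ?thesis by blast
qed

lemma gdist_step_left:
  assumes "x \<rightarrow> y" "z \<in> verts G"
  shows "gdist G x z \<le> gdist G y z + 1"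
proof -
  obtain p where p: "awalk y p z" "gdist G y z = length p"
    using shortest_awalk[of y z] assms adj_in_verts(2) by blast
  obtain e where "e \<in> arcs G" "tail G e = x" "head G e = y"
    using assms(1) by (auto simp: arcs_ends_conv)
  then have "awalk x (e # p) z" using p(1) by (simp add: awalk_Cons_iff)
  then show ?thesis using gdist_le_length[of x "e # p" z] p(2) by simp
qed

lemma gdist_step_right:
  assumes "x \<rightarrow> y" "z \<in> verts G"
  shows "gdist G z y \<le> gdist G z x + 1"
proof -
  obtain p where p: "awalk z p x" "gdist G z x = length p"
    using shortest_awalk[of z x] assms adj_in_verts(1) by blast
  obtain e where "e \<in> arcs G" "tail G e = x" "head G e = y"
    using assms(1) by (auto simp: arcs_ends_conv)
  then have "awalk x [e] y" using arc_implies_awalk by auto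
  then have "awalk z (p @ [e]) y" using p(1) by (rule awalk_appendI[rotated])
  then show ?thesis using gdist_le_length[of z "p @ [e]" y] p(2) by simp
qed

text \<open>A detour needs a neighbour to go to; the only connected graph with a vertex that has none is
  the single vertex, where nobody ever moves.\<close>

lemma neighbour_exists:
  assumes "u \<rightarrow> v" "w \<in> verts G"
  obtains x where "w \<rightarrow> x"
proof -
  have "w = z \<or> (\<exists>x. w \<rightarrow> x)" if "w \<rightarrow>\<^sup>* z" for z
    using that by (induction rule: converse_reachable_induct) auto
  moreover have "u \<noteq> v" using assms(1) by (rule adj_distinct)
  moreover have "w \<rightarrow>\<^sup>* u" "w \<rightarrow>\<^sup>* v"
    using assms reachable_verts adj_in_verts by blast+
  ultimately show ?thesis using that by blast
qed

section \<open>Joint walks\<close>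

definition joint_walk :: "nat \<Rightarrow> nat \<Rightarrow> (nat \<Rightarrow> 'a) \<Rightarrow> (nat \<Rightarrow> 'a) \<Rightarrow> bool" where
  "joint_walk k l f g \<longleftrightarrow> l \<ge> 1 \<and>
     (\<forall>i\<in>{1..l}. f i \<in> verts G \<and> g i \<in> verts G \<and> k \<le> gdist G (f i) (g i)) \<and>
     (\<forall>i\<in>{1..<l}. f i \<rightarrow> f (i + 1) \<and> g i \<rightarrow> g (i + 1))"

definition traced :: "nat \<Rightarrow> (nat \<Rightarrow> 'a) \<Rightarrow> 'a set set" where
  "traced l f = (\<lambda>i. {f i, f (i + 1)}) ` {1..<l}"

lemma covers_edges_traced:
  "covers_edges G l f \<longleftrightarrow> (\<forall>u v. u \<rightarrow> v \<longrightarrow> {u, v} \<in> traced l f)"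
proof -
  have "{u, v} \<in> traced l f \<longleftrightarrow> (\<exists>i\<in>{1..<l}. {f i, f (i + 1)} = {u, v})" for u v
    unfolding traced_def by blast
  then show ?thesis by (simp add: covers_edges_def)
qed

lemma traced_snoc:
  assumes "l \<ge> 1"
  shows "traced (Suc l) (f(Suc l := x)) = insert {f l, x} (traced l f)"
proof -
  have "{1..<Suc l} = insert l {1..<l}" using assms by auto
  then show ?thesis unfolding traced_def by auto
qed

lemma joint_walk_start:
  assumes "u \<in> verts G" "v \<in> verts G" "k \<le> gdist G u v"
  shows "joint_walk k 1 (\<lambda>_. u) (\<lambda>_. v)"
  using assms by (simp add: joint_walk_def)

lemma joint_walk_snoc:
  assumes "joint_walk k l f g" "f l \<rightarrow> x" "g l \<rightarrow> y" "k \<le> gdist G x y"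
  shows "joint_walk k (Suc l) (f(Suc l := x)) (g(Suc l := y))"
proof -
  have "x \<in> verts G" "y \<in> verts G" using assms adj_in_verts by blast+
  moreover have "(f(Suc l := x)) i \<rightarrow> (f(Suc l := x)) (i + 1)"
    "(g(Suc l := y)) i \<rightarrow> (g(Suc l := y)) (i + 1)" if "i \<in> {1..<Suc l}" for i
    using that assms by (cases "i = l"; auto simp: joint_walk_def)+
  ultimately show ?thesis using assms unfolding joint_walk_def by auto
qed

lemma joint_walk_extend:
  assumes "joint_walk k l f g" "f l = a" "g l = c" "a \<rightarrow> x" "c \<rightarrow> y" "k \<le> gdist G x y"
  obtains l' f' g' where "joint_walk k l' f' g'" "f' l' = x" "g' l' = y"
    "traced l' f' = insert {a, x} (traced l f)" "traced l' g' = insert {c, y} (traced l g)"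
proof -
  have "l \<ge> 1" using assms(1) by (simp add: joint_walk_def)
  show ?thesis
    by (rule that[OF joint_walk_snoc[OF assms(1), of x y]])
      (use assms in \<open>simp_all add: traced_snoc[OF \<open>l \<ge> 1\<close>]\<close>)
qed

text \<open>Tracing all edges forces visiting all vertices: by connectedness, a vertex other than the
  start is the end of some edge.\<close>

lemma sweep_of_walk:
  assumes "l \<ge> 1" and verts: "\<And>i. i \<in> {1..l} \<Longrightarrow> f i \<in> verts G"
    and steps: "\<And>i. i \<in> {1..<l} \<Longrightarrow> f i \<rightarrow> f (i + 1)"
    and cov: "covers_edges G l f"
  shows "sweep G l f"
proof -
  have "v \<in> f ` {1..l}" if "v \<in> verts G" for v
  proof -
    have "f 1 \<rightarrow>\<^sup>* v" using verts[of 1] \<open>l \<ge> 1\<close> that by (simp add: reachable_verts)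
    then show ?thesis
    proof (induction rule: reachable_induct)
      case base
      show ?case using \<open>l \<ge> 1\<close> by auto
    next
      case (step x y)
      then obtain i where "i \<in> {1..<l}" "{f i, f (i + 1)} = {x, y}"
        using cov unfolding covers_edges_def by blast
      then have "y = f i \<or> y = f (i + 1)" "i \<in> {1..l}" "i + 1 \<in> {1..l}" by auto
      then show ?case by blast
    qed
  qed
  then have "f ` {1..l} = verts G" using verts by blast
  then show ?thesis using assms by (auto simp: sweep_def track_def)
qed

lemma sweeps_of_joint_walk:
  assumes "joint_walk k l f g" "covers_edges G l f" "covers_edges G l g"
  shows "sweep G l f" "sweep G l g"
  using assms by (auto simp: joint_walk_def intro!: sweep_of_walk)

lemma min_dist_ge_iff:
  assumes "l \<ge> 1"
  shows "k \<le> min_dist G l f g \<longleftrightarrow> (\<forall>i\<in>{1..l}. k \<le> gdist G (f i) (g i))"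
  using assms by (simp add: min_dist_def)

section \<open>Existence of sweeps\<close>

text \<open>A single walk is a joint walk of two players who stay together, at distance bound \<open>0\<close>. Any
  walk can be continued to any prescribed vertex.\<close>

lemma walk_to_vertex:
  assumes "joint_walk 0 l f f" "v \<in> verts G"
  obtains l' f' where "joint_walk 0 l' f' f'" "f' l' = v" "traced l f \<subseteq> traced l' f'"
proof -
  have "f l \<in> verts G" using assms(1) by (auto simp: joint_walk_def)
  then have "f l \<rightarrow>\<^sup>* v" using assms(2) by (rule reachable_verts)
  then have "\<exists>l' f'. joint_walk 0 l' f' f' \<and> f' l' = v \<and> traced l f \<subseteq> traced l' f'"
  proof (induction rule: reachable_induct)
    case base
    show ?case using assms(1) by blast
  next
    case (step x y)
    then obtain l' f' where w: "joint_walk 0 l' f' f'" "f' l' = x" "traced l f \<subseteq> traced l' f'"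
      by blast
    then have "joint_walk 0 (Suc l') (f'(Suc l' := y)) (f'(Suc l' := y))"
      using step.hyps by (intro joint_walk_snoc) auto
    moreover have "traced l f \<subseteq> traced (Suc l') (f'(Suc l' := y))"
      using w traced_snoc[of l' f' y] by (auto simp: joint_walk_def)
    ultimately show ?case by (metis fun_upd_same)
  qed
  with that show ?thesis by blast
qed

text \<open>Walk to the tail of each arc in turn and traverse it.\<close>

lemma sweep_exists: "\<exists>l f. sweep G l f"
proof -
  have "\<exists>l f. joint_walk 0 l f f \<and> (\<forall>(u, v)\<in>A. {u, v} \<in> traced l f)"
    if "finite A" "A \<subseteq> arcs_ends G" for A
    using that
  proof (induction A rule: finite_induct)
    case empty
    obtain v where "v \<in> verts G"
      using symmetric_connected_imp_strongly_connected[OF sym_arcs connected_G]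
      by (auto simp: strongly_connected_def)
    then have "joint_walk 0 1 (\<lambda>_. v) (\<lambda>_. v)" by (intro joint_walk_start) auto
    then show ?case by blast
  next
    case (insert a A)
    obtain u v where a: "a = (u, v)" by (cases a)
    then have uv: "u \<rightarrow> v" using insert.prems by simp
    from insert obtain l f where w: "joint_walk 0 l f f" "\<forall>(u, v)\<in>A. {u, v} \<in> traced l f"
      by auto
    obtain l' f' where w': "joint_walk 0 l' f' f'" "f' l' = u" "traced l f \<subseteq> traced l' f'"
      using walk_to_vertex[OF w(1)] uv adj_in_verts(1) by metis
    have "joint_walk 0 (Suc l') (f'(Suc l' := v)) (f'(Suc l' := v))"
      using w' uv by (intro joint_walk_snoc) auto
    moreover have "traced (Suc l') (f'(Suc l' := v)) = insert {u, v} (traced l' f')"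
      using w' traced_snoc[of l' f' v] by (auto simp: joint_walk_def)
    ultimately show ?case using w w' a by fast
  qed
  moreover have "finite (arcs_ends G)" by (simp add: arcs_ends_def)
  ultimately obtain l f where w: "joint_walk 0 l f f" "\<forall>(u, v)\<in>arcs_ends G. {u, v} \<in> traced l f"
    by blast
  then have "covers_edges G l f" by (auto simp: covers_edges_traced)
  then show ?thesis using sweeps_of_joint_walk(1)[OF w(1)] by blast
qed

section \<open>From simultaneous to alternating moves\<close>

text \<open>Move number \<open>i\<close> is spread over the times \<open>2 i - 1\<close> and \<open>2 i\<close>: the first player moves at the
  odd time, the second one at the even time. This gives the indices below.\<close>

lemma opposite_sweeps_of_sweeps:
  assumes f: "sweep G l f" and g: "sweep G l g"
  shows "\<exists>l' f' g'. lazy_sweep G l' f' \<and> lazy_sweep G l' g' \<and> opposite G l' f' g' \<and>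
           min_dist G l f g \<le> min_dist G l' f' g' + 1"
proof -
  define l' where "l' = 2 * l - 1"
  define f' where "f' k = f (k div 2 + 1)" for k
  define g' where "g' k = g ((k + 1) div 2)" for k
  have l: "l \<ge> 1" "l' \<ge> 1" using f by (auto simp: sweep_def track_def l'_def)
  have fs: "f i \<rightarrow> f (i + 1)" and gs: "g i \<rightarrow> g (i + 1)" if "i \<in> {1..<l}" for i
    using that f g by (auto simp: sweep_def track_def)
  have fv: "f ` {1..l} = verts G" and gv: "g ` {1..l} = verts G"
    using f g by (auto simp: sweep_def track_def)
  have odd: "f' (2 * i - 1) = f i" "g' (2 * i - 1) = g i" if "i \<ge> 1" for i
  proof -
    from that obtain j where "i = Suc j" by (cases i) auto
    then show "f' (2 * i - 1) = f i" "g' (2 * i - 1) = g i" by (auto simp: f'_def g'_def)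
  qed
  have even: "f' (2 * i) = f (i + 1)" "g' (2 * i) = g i" for i
    by (auto simp: f'_def g'_def)
  have time: thesis if "k \<in> {1..l'}"
    "\<And>i. k = 2 * i - 1 \<Longrightarrow> i \<in> {1..l} \<Longrightarrow> k + 1 = 2 * i \<Longrightarrow> k < l' \<longrightarrow> i < l \<Longrightarrow> thesis"
    "\<And>i. k = 2 * i \<Longrightarrow> i \<in> {1..<l} \<Longrightarrow> k + 1 = 2 * (i + 1) - 1 \<Longrightarrow> thesis" for k thesis
  proof (cases "even k")
    case True
    then obtain i where "k = 2 * i" by blast
    then show ?thesis using that(1) by (intro that(3)[of i]) (auto simp: l'_def)
  next
    case False
    then obtain i where "k = 2 * i + 1" by (blast elim: oddE)
    then show ?thesis using that(1) by (intro that(2)[of "i + 1"]) (auto simp: l'_def)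
  qed
  have moves: "f' k \<rightarrow> f' (k + 1) \<and> g' k = g' (k + 1) \<or> f' k = f' (k + 1) \<and> g' k \<rightarrow> g' (k + 1)"
    if k: "k \<in> {1..<l'}" for k
  proof (rule time[of k])
    show "k \<in> {1..l'}" using k by simp
  next
    fix i assume "k = 2 * i - 1" "i \<in> {1..l}" "k + 1 = 2 * i" "k < l' \<longrightarrow> i < l"
    then show ?thesis using odd[of i] even[of i] fs[of i] k by auto
  next
    fix i assume "k = 2 * i" "i \<in> {1..<l}" "k + 1 = 2 * (i + 1) - 1"
    then show ?thesis using odd[of "i + 1"] even[of i] gs[of i] by auto
  qed
  have dist: "min_dist G l f g \<le> gdist G (f' k) (g' k) + 1" if k: "k \<in> {1..l'}" for k
  proof -
    have le: "min_dist G l f g \<le> gdist G (f i) (g i)" if "i \<in> {1..l}" for i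
      using min_dist_ge_iff[OF l(1), of "min_dist G l f g"] that by blast
    show ?thesis
    proof (rule time[OF k])
      fix i assume "k = 2 * i - 1" "i \<in> {1..l}"
      then show ?thesis using odd[of i] le[of i] by auto
    next
      fix i assume i: "k = 2 * i" "i \<in> {1..<l}"
      then have "g i \<in> verts G" using gv by auto
      then have "gdist G (f i) (g i) \<le> gdist G (f (i + 1)) (g i) + 1"
        using fs[OF i(2)] by (intro gdist_step_left)
      then show ?thesis using even[of i] le[of i] i by auto
    qed
  qed
  have "f' ` {1..l'} = f ` {1..l}" "g' ` {1..l'} = g ` {1..l}"
  proof -
    have "f' k \<in> f ` {1..l} \<and> g' k \<in> g ` {1..l}" if k: "k \<in> {1..l'}" for k
    proof (rule time[OF k])
      fix i assume "k = 2 * i - 1" "i \<in> {1..l}"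
      then show ?thesis using odd[of i] by auto
    next
      fix i assume "k = 2 * i" "i \<in> {1..<l}"
      then show ?thesis using even[of i] by auto
    qed
    moreover have "f i \<in> f' ` {1..l'} \<and> g i \<in> g' ` {1..l'}" if "i \<in> {1..l}" for i
    proof -
      have "2 * i - 1 \<in> {1..l'}" using that by (auto simp: l'_def)
      then show ?thesis using odd[of i] that by (metis atLeastAtMost_iff image_eqI)
    qed
    ultimately show "f' ` {1..l'} = f ` {1..l}" "g' ` {1..l'} = g ` {1..l}" by blast+
  qed
  then have tracks: "lazy_track G l' f'" "lazy_track G l' g'"
    unfolding lazy_track_def using l(2) fv gv moves by (simp_all del: One_nat_def) fastforce+
  have "traced l f \<subseteq> traced l' f'" "traced l g \<subseteq> traced l' g'"
  proof -
    have "{f i, f (i + 1)} \<in> traced l' f' \<and> {g i, g (i + 1)} \<in> traced l' g'"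
      if i: "i \<in> {1..<l}" for i
    proof -
      have t: "2 * i - 1 \<in> {1..<l'}" "2 * i \<in> {1..<l'}" using i by (auto simp: l'_def)
      have s: "2 * i - 1 + 1 = 2 * i" "2 * i + 1 = 2 * (i + 1) - 1" using i by auto
      have "{f i, f (i + 1)} = {f' (2 * i - 1), f' (2 * i - 1 + 1)}"
        unfolding s using odd[of i] even[of i] i by simp
      moreover have "{g i, g (i + 1)} = {g' (2 * i), g' (2 * i + 1)}"
        unfolding s(2) using odd[of "i + 1"] even[of i] by simp
      ultimately show ?thesis using t unfolding traced_def by blast
    qed
    then show "traced l f \<subseteq> traced l' f'" "traced l g \<subseteq> traced l' g'"
      by (auto simp: traced_def)
  qed
  then have "lazy_sweep G l' f'" "lazy_sweep G l' g'"
    using f g tracks by (auto simp: lazy_sweep_def sweep_def covers_edges_traced)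
  moreover have "opposite G l' f' g'"
    unfolding opposite_def
  proof
    fix k assume "k \<in> {1..<l'}"
    then show "f' k \<rightarrow> f' (k + 1) \<longleftrightarrow> g' k = g' (k + 1)"
      using moves[of k] adj_distinct by metis
  qed
  moreover have "min_dist G l f g - 1 \<le> min_dist G l' f' g'"
    unfolding min_dist_ge_iff[OF l(2)] using dist by fastforce
  ultimately show ?thesis by (metis le_diff_conv)
qed

section \<open>From alternating to simultaneous moves\<close>

definition traces_moves :: "nat \<Rightarrow> (nat \<Rightarrow> 'a) \<Rightarrow> nat \<Rightarrow> (nat \<Rightarrow> 'a) \<Rightarrow> bool" where
  "traces_moves m f l' f' \<longleftrightarrow>
     (\<forall>i\<in>{1..<m}. f i \<noteq> f (i + 1) \<longrightarrow> {f i, f (i + 1)} \<in> traced l' f')"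

lemma traces_moves_Suc:
  "m \<ge> 1 \<Longrightarrow> traces_moves (Suc m) f l' f' \<longleftrightarrow>
     traces_moves m f l' f' \<and> (f m \<noteq> f (Suc m) \<longrightarrow> {f m, f (Suc m)} \<in> traced l' f')"
  by (auto simp: traces_moves_def less_Suc_eq)

lemma traces_moves_mono:
  "traces_moves m f l' f' \<Longrightarrow> traced l' f' \<subseteq> traced l'' f'' \<Longrightarrow> traces_moves m f l'' f''"
  by (auto simp: traces_moves_def)

lemma covers_edges_traces_moves:
  assumes "covers_edges G l f" "traces_moves l f l' f'"
  shows "covers_edges G l' f'"
  unfolding covers_edges_traced
proof (intro allI impI)
  fix u v assume uv: "u \<rightarrow> v"
  then obtain i where i: "i \<in> {1..<l}" "{f i, f (i + 1)} = {u, v}"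
    using assms(1) unfolding covers_edges_def by blast
  moreover have "u \<noteq> v" using uv by (rule adj_distinct)
  ultimately have "f i \<noteq> f (i + 1)" by auto
  then show "{u, v} \<in> traced l' f'" using assms(2) i by (auto simp: traces_moves_def)
qed

context
  fixes l d :: nat and f g :: "nat \<Rightarrow> 'a"
  assumes verts_fg: "\<And>i. i \<in> {1..l} \<Longrightarrow> f i \<in> verts G \<and> g i \<in> verts G"
    and moves: "\<And>i. i \<in> {1..<l} \<Longrightarrow>
      f i \<rightarrow> f (Suc i) \<and> g i = g (Suc i) \<or> f i = f (Suc i) \<and> g i \<rightarrow> g (Suc i)"
    and dist: "\<And>i. i \<in> {1..l} \<Longrightarrow> d \<le> gdist G (f i) (g i)"
begin

text \<open>While one player moves, the other one can step aside and lose at most one unit of distance.\<close>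

lemma step_aside:
  assumes i: "i \<in> {1..<l}"
  shows "f i \<rightarrow> f (Suc i) \<and> g i = g (Suc i) \<and>
           (\<exists>y. g i \<rightarrow> y \<and> d - 1 \<le> gdist G (f (Suc i)) y) \<or>
         f i = f (Suc i) \<and> g i \<rightarrow> g (Suc i) \<and>
           (\<exists>x. f i \<rightarrow> x \<and> d - 1 \<le> gdist G x (g (Suc i)))"
  using moves[OF i]
proof (elim disjE conjE)
  assume m: "f i \<rightarrow> f (Suc i)" "g i = g (Suc i)"
  then obtain y where y: "g i \<rightarrow> y"
    using neighbour_exists[of "f i" "f (Suc i)" "g i"] verts_fg[of i] i by auto
  have "d \<le> gdist G (f (Suc i)) (g (Suc i))" using dist[of "Suc i"] i by auto
  also have "\<dots> \<le> gdist G (f (Suc i)) y + 1"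
    using gdist_step_right[of y "g (Suc i)" "f (Suc i)"] y m verts_fg[of "Suc i"] i adj_sym by auto
  finally show ?thesis using y m by auto
next
  assume m: "f i = f (Suc i)" "g i \<rightarrow> g (Suc i)"
  then obtain x where x: "f i \<rightarrow> x"
    using neighbour_exists[of "g i" "g (Suc i)" "f i"] verts_fg[of i] i by auto
  have "d \<le> gdist G (f (Suc i)) (g (Suc i))" using dist[of "Suc i"] i by auto
  also have "\<dots> \<le> gdist G x (g (Suc i)) + 1"
    using gdist_step_left[of "f (Suc i)" x "g (Suc i)"] x m verts_fg[of "Suc i"] i by auto
  finally show ?thesis using x m by auto
qed

text \<open>The block of two moves starting at time \<open>i\<close>: when both moves belong to the same player, the
  other one takes a detour; otherwise they are merged.\<close>

lemma joint_walk_block: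
  assumes i: "i \<ge> 1" "Suc i < l"
    and w: "joint_walk (d - 1) L F H" "F L = f i" "H L = g i"
    and t: "traces_moves i f L F" "traces_moves i g L H"
  shows "\<exists>L' F' H'. joint_walk (d - 1) L' F' H' \<and> F' L' = f (i + 2) \<and> H' L' = g (i + 2) \<and>
           traces_moves (i + 2) f L' F' \<and> traces_moves (i + 2) g L' H'"
proof -
  have i1: "i \<in> {1..<l}" and i2: "Suc i \<in> {1..<l}" using i by auto
  have d2: "d - 1 \<le> gdist G (f (i + 2)) (g (i + 2))" using dist[of "i + 2"] i by auto
  have traces: "traces_moves (i + 2) f L' F' \<and> traces_moves (i + 2) g L' H'"
    if "traced L F \<subseteq> traced L' F'" "traced L H \<subseteq> traced L' H'"
      "f i \<noteq> f (Suc i) \<longrightarrow> {f i, f (Suc i)} \<in> traced L' F'"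
      "f (Suc i) \<noteq> f (i + 2) \<longrightarrow> {f (Suc i), f (i + 2)} \<in> traced L' F'"
      "g i \<noteq> g (Suc i) \<longrightarrow> {g i, g (Suc i)} \<in> traced L' H'"
      "g (Suc i) \<noteq> g (i + 2) \<longrightarrow> {g (Suc i), g (i + 2)} \<in> traced L' H'" for L' F' H'
    using that i(1) traces_moves_mono[OF t(1)] traces_moves_mono[OF t(2)]
    by (simp add: traces_moves_Suc)
  have move2: "f (Suc i) \<rightarrow> f (i + 2) \<and> g (Suc i) = g (i + 2) \<or>
      f (Suc i) = f (i + 2) \<and> g (Suc i) \<rightarrow> g (i + 2)"
    using moves[OF i2] by simp
  have merged: ?thesis if m: "f i \<rightarrow> f (i + 2)" "g i \<rightarrow> g (i + 2)"
    "f (Suc i) = f i \<or> f (Suc i) = f (i + 2)" "g (Suc i) = g i \<or> g (Suc i) = g (i + 2)"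
  proof -
    obtain L' F' H' where w': "joint_walk (d - 1) L' F' H'" "F' L' = f (i + 2)" "H' L' = g (i + 2)"
      "traced L' F' = insert {f i, f (i + 2)} (traced L F)"
      "traced L' H' = insert {g i, g (i + 2)} (traced L H)"
      by (rule joint_walk_extend[OF w m(1,2) d2])
    have "traces_moves (i + 2) f L' F' \<and> traces_moves (i + 2) g L' H'"
      by (rule traces) (use w' that in auto)
    with w' show ?thesis by blast
  qed
  have detour: ?thesis
    if m: "f i \<rightarrow> x" "g i \<rightarrow> y" "x \<rightarrow> f (i + 2)" "y \<rightarrow> g (i + 2)" "d - 1 \<le> gdist G x y"
      "x = f (Suc i) \<or> f i = f (Suc i) \<and> f (Suc i) = f (i + 2)"
      "y = g (Suc i) \<or> g i = g (Suc i) \<and> g (Suc i) = g (i + 2)" for x y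
  proof -
    obtain L1 F1 H1 where w1: "joint_walk (d - 1) L1 F1 H1" "F1 L1 = x" "H1 L1 = y"
      "traced L1 F1 = insert {f i, x} (traced L F)"
      "traced L1 H1 = insert {g i, y} (traced L H)"
      by (rule joint_walk_extend[OF w m(1,2,5)])
    obtain L2 F2 H2 where w2: "joint_walk (d - 1) L2 F2 H2" "F2 L2 = f (i + 2)" "H2 L2 = g (i + 2)"
      "traced L2 F2 = insert {x, f (i + 2)} (traced L1 F1)"
      "traced L2 H2 = insert {y, g (i + 2)} (traced L1 H1)"
      by (rule joint_walk_extend[OF w1(1-3) m(3,4) d2])
    have "traces_moves (i + 2) f L2 F2 \<and> traces_moves (i + 2) g L2 H2"
      by (rule traces) (use w1 w2 that in auto)
    with w2 show ?thesis by blast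
  qed
  from step_aside[OF i1] show ?thesis
  proof (elim disjE conjE exE)
    fix y assume a: "f i \<rightarrow> f (Suc i)" "g i = g (Suc i)" "g i \<rightarrow> y"
      "d - 1 \<le> gdist G (f (Suc i)) y"
    from move2 show ?thesis
    proof (elim disjE conjE)
      assume "f (Suc i) \<rightarrow> f (i + 2)" "g (Suc i) = g (i + 2)"
      then show ?thesis using a adj_sym by (intro detour[of "f (Suc i)" y]) auto
    next
      assume "f (Suc i) = f (i + 2)" "g (Suc i) \<rightarrow> g (i + 2)"
      then show ?thesis using a by (intro merged) auto
    qed
  next
    fix x assume a: "f i = f (Suc i)" "g i \<rightarrow> g (Suc i)" "f i \<rightarrow> x"
      "d - 1 \<le> gdist G x (g (Suc i))"
    from move2 show ?thesis
    proof (elim disjE conjE)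
      assume "f (Suc i) \<rightarrow> f (i + 2)" "g (Suc i) = g (i + 2)"
      then show ?thesis using a by (intro merged) auto
    next
      assume "f (Suc i) = f (i + 2)" "g (Suc i) \<rightarrow> g (i + 2)"
      then show ?thesis using a adj_sym by (intro detour[of x "g (Suc i)"]) auto
    qed
  qed
qed

text \<open>Blocks end at the odd times \<open>2 n + 1\<close>, because time starts at \<open>1\<close>.\<close>

lemma joint_walk_blocks:
  assumes "Suc (2 * n) \<le> l"
  shows "\<exists>L F H. joint_walk (d - 1) L F H \<and> F L = f (Suc (2 * n)) \<and> H L = g (Suc (2 * n)) \<and>
           traces_moves (Suc (2 * n)) f L F \<and> traces_moves (Suc (2 * n)) g L H"
  using assms
proof (induction n)
  case 0
  then have "joint_walk (d - 1) 1 (\<lambda>_. f 1) (\<lambda>_. g 1)"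
    using verts_fg[of 1] dist[of 1] by (intro joint_walk_start) auto
  then show ?case by (auto simp: traces_moves_def)
next
  case (Suc n)
  then obtain L F H where "joint_walk (d - 1) L F H" "F L = f (Suc (2 * n))"
    "H L = g (Suc (2 * n))" "traces_moves (Suc (2 * n)) f L F" "traces_moves (Suc (2 * n)) g L H"
    by auto
  from joint_walk_block[OF _ _ this] Suc.prems show ?case by simp
qed

lemma joint_walk_of_moves:
  assumes "l \<ge> 1"
  shows "\<exists>L F H. joint_walk (d - 1) L F H \<and> traces_moves l f L F \<and> traces_moves l g L H"
proof (cases "odd l")
  case True
  then obtain n where "l = Suc (2 * n)" by (auto elim: oddE)
  then show ?thesis using joint_walk_blocks[of n] by auto
next
  case False
  \<comment> \<open>A last move is left over; the other player steps aside and need not return.\<close>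
  define i where "i = l - 1"
  have "odd i" using False assms by (simp add: i_def)
  then obtain n where n: "i = Suc (2 * n)" by (auto elim: oddE)
  have i: "i \<in> {1..<l}" "Suc i = l" "i \<ge> 1" using n by (auto simp: i_def)
  obtain L F H where w: "joint_walk (d - 1) L F H" "F L = f i" "H L = g i"
    and t: "traces_moves i f L F" "traces_moves i g L H"
    using joint_walk_blocks[of n] n i by auto
  have extend: ?thesis
    if m: "f i \<rightarrow> x" "g i \<rightarrow> y" "d - 1 \<le> gdist G x y"
      "x = f l \<or> f i = f l" "y = g l \<or> g i = g l" for x y
  proof -
    obtain L' F' H' where w': "joint_walk (d - 1) L' F' H'"
      "traced L' F' = insert {f i, x} (traced L F)"
      "traced L' H' = insert {g i, y} (traced L H)"
      by (rule joint_walk_extend[OF w m(1-3)])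
    have "traces_moves i f L' F'" "traces_moves i g L' H'"
      using traces_moves_mono[OF t(1)] traces_moves_mono[OF t(2)] w'(2,3) by blast+
    then have "traces_moves (Suc i) f L' F'" "traces_moves (Suc i) g L' H'"
      using w'(2,3) m i(2) by (auto simp: traces_moves_Suc[OF i(3)])
    with w'(1) i(2) show ?thesis by auto
  qed
  from step_aside[OF i(1)] show ?thesis unfolding i(2) using extend by blast
qed

end

lemma sweeps_of_opposite_sweeps:
  assumes f: "lazy_sweep G l f" and g: "lazy_sweep G l g" and opp: "opposite G l f g"
  shows "\<exists>l' f' g'. sweep G l' f' \<and> sweep G l' g' \<and> min_dist G l f g \<le> min_dist G l' f' g' + 1"
proof -
  define d where "d = min_dist G l f g"
  have l: "l \<ge> 1" using f by (simp add: lazy_sweep_def lazy_track_def)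
  have "f i \<in> verts G \<and> g i \<in> verts G" if "i \<in> {1..l}" for i
    using f g that by (auto simp: lazy_sweep_def lazy_track_def)
  moreover have "f i \<rightarrow> f (Suc i) \<and> g i = g (Suc i) \<or> f i = f (Suc i) \<and> g i \<rightarrow> g (Suc i)"
    if "i \<in> {1..<l}" for i
  proof -
    have "f i \<rightarrow> f (i + 1) \<or> f i = f (i + 1)" "g i \<rightarrow> g (i + 1) \<or> g i = g (i + 1)"
      "f i \<rightarrow> f (i + 1) \<longleftrightarrow> g i = g (i + 1)"
      using f g opp that by (simp_all add: lazy_sweep_def lazy_track_def opposite_def)
    then show ?thesis by auto
  qed
  moreover have "d \<le> gdist G (f i) (g i)" if "i \<in> {1..l}" for i
    using min_dist_ge_iff[OF l, of d] that unfolding d_def by blast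
  ultimately obtain L F H where w: "joint_walk (d - 1) L F H"
    and t: "traces_moves l f L F" "traces_moves l g L H"
    using joint_walk_of_moves[of l f g d] l by blast
  have "covers_edges G L F" "covers_edges G L H"
    using f g t covers_edges_traces_moves unfolding lazy_sweep_def by blast+
  with w have "sweep G L F" "sweep G L H" by (blast intro: sweeps_of_joint_walk)+
  moreover have "d - 1 \<le> min_dist G L F H"
    using w min_dist_ge_iff[of L "d - 1"] by (simp add: joint_walk_def)
  ultimately show ?thesis unfolding d_def by (metis le_diff_conv)
qed

section \<open>Comparison of the spans\<close>

lemma min_dist_in_distances:
  assumes "l \<ge> 1" "f ` {1..l} = verts G" "g ` {1..l} = verts G"
  shows "min_dist G l f g \<in> (\<lambda>(u, v). gdist G u v) ` (verts G \<times> verts G)"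
proof -
  have "min_dist G l f g \<in> (\<lambda>i. gdist G (f i) (g i)) ` {1..l}"
    unfolding min_dist_def using assms(1) by (intro Min_in) auto
  then show ?thesis using assms(2,3) by fastforce
qed

lemma finite_distances: "finite ((\<lambda>(u, v). gdist G u v) ` (verts G \<times> verts G))"
  by simp

end

lemma Max_le_Max_plus_one:
  fixes A B :: "nat set"
  assumes "finite A" "A \<noteq> {}" "finite B" "\<And>a. a \<in> A \<Longrightarrow> \<exists>b\<in>B. a \<le> b + 1"
  shows "Max A \<le> Max B + 1"
proof -
  obtain b where "b \<in> B" "Max A \<le> b + 1" using assms Max_in by blast
  moreover have "b \<le> Max B" using assms(3) \<open>b \<in> B\<close> by (rule Max_ge)
  ultimately show ?thesis by simp
qed

theorem theorem5p7:
  fixes G :: "('a, 'b) pre_digraph"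
  assumes "graph G" and "Digraph_Component.connected G"
  shows "\<bar>int (direct_edge_span G) - int (cartesian_edge_span G)\<bar> \<le> 1"
proof -
  interpret graph G by fact
  interpret connected_graph G by unfold_locales fact
  define D where "D = {min_dist G l f g | l f g. sweep G l f \<and> sweep G l g}"
  define C where
    "C = {min_dist G l f g | l f g. lazy_sweep G l f \<and> lazy_sweep G l g \<and> opposite G l f g}"
  have "D \<subseteq> (\<lambda>(u, v). gdist G u v) ` (verts G \<times> verts G)"
    unfolding D_def sweep_def track_def by (blast intro: min_dist_in_distances)
  then have fin_D: "finite D" using finite_distances by (rule finite_subset)
  have "C \<subseteq> (\<lambda>(u, v). gdist G u v) ` (verts G \<times> verts G)"
    unfolding C_def lazy_sweep_def lazy_track_def by (blast intro: min_dist_in_distances)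
  then have fin_C: "finite C" using finite_distances by (rule finite_subset)
  have D_C: "\<exists>c\<in>C. a \<le> c + 1" if "a \<in> D" for a
  proof -
    obtain l f g where "a = min_dist G l f g" "sweep G l f" "sweep G l g"
      using \<open>a \<in> D\<close> unfolding D_def by blast
    with opposite_sweeps_of_sweeps[of l f g] show ?thesis unfolding C_def by blast
  qed
  have C_D: "\<exists>b\<in>D. a \<le> b + 1" if "a \<in> C" for a
  proof -
    obtain l f g where
      "a = min_dist G l f g" "lazy_sweep G l f" "lazy_sweep G l g" "opposite G l f g"
      using \<open>a \<in> C\<close> unfolding C_def by blast
    with sweeps_of_opposite_sweeps[of l f g] show ?thesis unfolding D_def by blast
  qed
  have "D \<noteq> {}" using sweep_exists unfolding D_def by blast
  moreover from this have "C \<noteq> {}" using D_C by blast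
  ultimately have "Max D \<le> Max C + 1" "Max C \<le> Max D + 1"
    using Max_le_Max_plus_one[OF fin_D _ fin_C D_C] Max_le_Max_plus_one[OF fin_C _ fin_D C_D]
    by simp_all
  moreover have "direct_edge_span G = Max D" "cartesian_edge_span G = Max C"
    by (simp_all add: direct_edge_span_def cartesian_edge_span_def C_def D_def)
  ultimately show ?thesis by linarith
qed

end
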